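(* Let $1<q<p$, $q<N$ and $t>q_*:=\frac{q(N-1)}{N-q}$. Then there exist $R_0>0$ and a positive function $\varphi$ satisfying $$-\Delta_p\varphi-\Delta_q\varphi\ge\varphi^{t-1}\quad\text{in }\{x\in\mathbb R^N:|x|>R_0\}.$$
   Context: For $r>1$, $\Delta_r u=\operatorname{div}(|\nabla u|^{r-2}\nabla u)$. A positive function $\varphi$ satisfies $-\Delta_p \varphi-\Delta_q \varphi\ge \varphi^{t-1}$ in an open set $\Omega$ if $\varphi\in C(\Omega)\cap W^{1,p}_{loc}(\Omega)$, $\varphi>0$, and $$\int_\Omega |\nabla \varphi|^{p-2}\nabla \varphi\cdot\nabla\eta\,dx+\int_\Omega |\nabla \varphi|^{q-2}\nabla \varphi\cdot\nabla\eta\,dx\ge \int_\Omega \varphi^{t-1}\eta\,dx\quad\text{for all }\eta\in C^1_c(\Omega),\ \eta\ge 0.$$ *)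

theory Defs
  imports "HOL-Analysis.Analysis"
begin

text \<open>\<open>L\<^sup>p\<^sub>l\<^sub>o\<^sub>c(\<Omega>)\<close> for finite \<open>p\<close>, for scalar- and vector-valued functions.\<close>

definition Lp_loc ::
  "real \<Rightarrow> (real ^ 'n) set \<Rightarrow> (real ^ 'n \<Rightarrow> 'b::euclidean_space) \<Rightarrow> bool" where
  "Lp_loc p \<Omega> f \<longleftrightarrow>
     (\<forall>K. compact K \<and> K \<subseteq> \<Omega> \<longrightarrow>
        set_borel_measurable lebesgue K f \<and>
        set_integrable lebesgue K (\<lambda>x. norm (f x) powr p))"

definition grad :: "(real ^ 'n \<Rightarrow> real) \<Rightarrow> real ^ 'n \<Rightarrow> real ^ 'n" where
  "grad f x = (\<chi> i. frechet_derivative f (at x) (axis i 1))"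

text \<open>Functions in \<open>C\<^sup>1\<^sub>c(\<Omega>)\<close>, \<open>\<Omega>\<close> open, are identified with their extensions by zero to the
  whole space, which are again continuously differentiable.\<close>

definition C1c :: "(real ^ 'n) set \<Rightarrow> (real ^ 'n \<Rightarrow> real) set" where
  "C1c \<Omega> = {\<eta>. (\<forall>x. \<eta> differentiable (at x)) \<and> continuous_on UNIV (grad \<eta>) \<and>
                compact (closure {x. \<eta> x \<noteq> 0}) \<and> closure {x. \<eta> x \<noteq> 0} \<subseteq> \<Omega>}"

text \<open>\<open>g\<close> is a weak gradient of \<open>u\<close> on \<open>\<Omega>\<close>. It is determined by \<open>u\<close> almost everywhere on \<open>\<Omega>\<close>.
  Local integrability makes every integral below a genuine one rather than the default value 0.\<close>

definition weak_gradient ::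
  "(real ^ 'n) set \<Rightarrow> (real ^ 'n \<Rightarrow> real) \<Rightarrow> (real ^ 'n \<Rightarrow> real ^ 'n) \<Rightarrow> bool" where
  "weak_gradient \<Omega> u g \<longleftrightarrow>
     Lp_loc 1 \<Omega> u \<and> Lp_loc 1 \<Omega> g \<and>
     (\<forall>\<eta>\<in>C1c \<Omega>. \<forall>i.
        (LINT x:\<Omega>|lebesgue. u x * (grad \<eta> x $ i)) = - (LINT x:\<Omega>|lebesgue. (g x $ i) * \<eta> x))"

text \<open>\<open>u \<in> W\<^sup>1\<^sup>,\<^sup>p\<^sub>l\<^sub>o\<^sub>c(\<Omega>)\<close> with weak gradient \<open>g\<close>.\<close>

definition W1p_loc_grad ::
  "real \<Rightarrow> (real ^ 'n) set \<Rightarrow> (real ^ 'n \<Rightarrow> real) \<Rightarrow> (real ^ 'n \<Rightarrow> real ^ 'n) \<Rightarrow> bool" where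
  "W1p_loc_grad p \<Omega> u g \<longleftrightarrow> Lp_loc p \<Omega> u \<and> Lp_loc p \<Omega> g \<and> weak_gradient \<Omega> u g"

text \<open>The vector field \<open>\<bar>\<xi>\<bar>\<^sup>r\<^sup>-\<^sup>2 \<xi>\<close>, equal to 0 at \<open>\<xi> = 0\<close> also when \<open>r < 2\<close>.\<close>

definition flux :: "real \<Rightarrow> real ^ 'n \<Rightarrow> real ^ 'n" where
  "flux r \<xi> = (norm \<xi> powr (r - 2)) *\<^sub>R \<xi>"

text \<open>\<open>\<phi>\<close> is a positive function with \<open>- \<Delta>\<^sub>p \<phi> - \<Delta>\<^sub>q \<phi> \<ge> \<phi>\<^sup>t\<^sup>-\<^sup>1\<close> in the open set \<open>\<Omega>\<close>. Since the weak
  gradient is unique almost everywhere, the choice of \<open>g\<close> is immaterial. The space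
  is \<open>W\<^sup>1\<^sup>,\<^sup>p\<^sub>l\<^sub>o\<^sub>c\<close>, so this is intended for \<open>1 < q \<le> p\<close>; values of \<open>\<phi>\<close> outside \<open>\<Omega>\<close> play no role.\<close>

definition positive_pq_supersolution ::
  "real \<Rightarrow> real \<Rightarrow> real \<Rightarrow> (real ^ 'n) set \<Rightarrow> (real ^ 'n \<Rightarrow> real) \<Rightarrow> bool" where
  "positive_pq_supersolution p q t \<Omega> \<phi> \<longleftrightarrow>
     open \<Omega> \<and> continuous_on \<Omega> \<phi> \<and> (\<forall>x\<in>\<Omega>. \<phi> x > 0) \<and>
     (\<exists>g. W1p_loc_grad p \<Omega> \<phi> g \<and>
        (\<forall>\<eta>\<in>C1c \<Omega>. (\<forall>x. \<eta> x \<ge> 0) \<longrightarrow>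
           (LINT x:\<Omega>|lebesgue. flux p (g x) \<bullet> grad \<eta> x) +
           (LINT x:\<Omega>|lebesgue. flux q (g x) \<bullet> grad \<eta> x)
           \<ge> (LINT x:\<Omega>|lebesgue. \<phi> x powr (t - 1) * \<eta> x)))"

definition q_star :: "real \<Rightarrow> real \<Rightarrow> real" where
  "q_star N q = q * (N - 1) / (N - q)"

end

theory Submission
  imports Defs
begin

text \<open>
  The pure power \<open>\<phi>(x) = \<bar>x\<bar>\<^sup>-\<^sup>a\<close> is a classical supersolution near infinity for a suitable \<open>a > 0\<close>.
  Away from the origin \<open>\<bar>\<nabla>\<phi>\<bar>\<^sup>r\<^sup>-\<^sup>2 \<nabla>\<phi> = - a\<^sup>r\<^sup>-\<^sup>1 \<bar>x\<bar>\<^sup>s x\<close> with \<open>s = -(a+1)(r-1) - 1\<close>, and the divergence of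
  \<open>\<bar>x\<bar>\<^sup>s x\<close> is \<open>(N+s) \<bar>x\<bar>\<^sup>s\<close>. Hence \<open>-\<Delta>\<^sub>q \<phi>\<close> is a positive multiple of \<open>\<bar>x\<bar>\<close> to the power
  \<open>-(a+1)(q-1) - 1\<close> as soon as \<open>a < (N-q)/(q-1)\<close>. It dominates \<open>\<phi>\<^sup>t\<^sup>-\<^sup>1 = \<bar>x\<bar>\<^sup>-\<^sup>a\<^sup>(\<^sup>t\<^sup>-\<^sup>1\<^sup>)\<close> at infinity as
  soon as \<open>a(t-1) > (a+1)(q-1) + 1\<close>, that is, \<open>a > q/(t-q)\<close>. The interval
  \<open>q/(t-q) < a < (N-q)/(q-1)\<close> is, for \<open>t > q\<close>, nonempty exactly when \<open>t\<close> exceeds the critical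
  exponent \<open>q(N-1)/(N-q)\<close>, which is itself larger than \<open>q\<close> (\<open>exponent_window\<close>). The term \<open>-\<Delta>\<^sub>p \<phi>\<close> may have the wrong sign, but since \<open>p > q\<close> it decays faster
  and is absorbed for large \<open>\<bar>x\<bar>\<close> (\<open>powr_dominates\<close>).

  To pass from the pointwise to the weak inequality one needs integration by parts against
  \<open>C\<^sup>1\<^sub>c\<close> test functions (\<open>integration_by_parts\<close>). It reduces to the fact that a partial
  derivative of a \<open>C\<^sup>1\<^sub>c\<close> function integrates to zero (\<open>integral_grad_C1c\<close>), which in turn
  follows from translation invariance of Lebesgue measure.
\<close>

section \<open>Gradients\<close>

lemma grad_eqI:
  fixes f :: "real ^ 'n \<Rightarrow> real"
  assumes "(f has_derivative (\<lambda>h. g \<bullet> h)) (at x)"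
  shows "grad f x = g"
proof -
  have "frechet_derivative f (at x) = (\<lambda>h. g \<bullet> h)"
    using frechet_derivative_at[OF assms] by simp
  then show ?thesis
    by (simp add: grad_def vec_eq_iff inner_axis)
qed

lemma has_derivative_grad:
  fixes f :: "real ^ 'n \<Rightarrow> real"
  assumes "f differentiable (at x)"
  shows "(f has_derivative (\<lambda>h. grad f x \<bullet> h)) (at x)"
proof -
  let ?D = "frechet_derivative f (at x)"
  have D: "(f has_derivative ?D) (at x)"
    using assms frechet_derivative_works by blast
  then have lin: "linear ?D" by (simp add: has_derivative_linear)
  have "?D h = grad f x \<bullet> h" for h
  proof -
    have "?D h = ?D (\<Sum>i\<in>UNIV. (h $ i) *\<^sub>R axis i 1)"
      using basis_expansion[of h] by (simp add: scalar_mult_eq_scaleR)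
    also have "\<dots> = (\<Sum>i\<in>UNIV. (h $ i) * ?D (axis i 1))"
      by (simp add: linear_sum[OF lin] linear_cmul[OF lin])
    also have "\<dots> = grad f x \<bullet> h"
      by (simp add: grad_def inner_vec_def mult.commute)
    finally show ?thesis .
  qed
  then have "?D = (\<lambda>h. grad f x \<bullet> h)" by auto
  with D show ?thesis by metis
qed

lemma grad_eq_0:
  fixes f :: "real ^ 'n \<Rightarrow> real"
  assumes "open U" "x \<in> U" "\<And>y. y \<in> U \<Longrightarrow> f y = 0"
  shows "grad f x = 0"
proof -
  have "(f has_derivative (\<lambda>h. 0 \<bullet> h)) (at x)"
    by (rule has_derivative_transform_within_open[of "\<lambda>_. 0" _ x UNIV U])
       (use assms in auto)
  then show ?thesis by (rule grad_eqI)
qed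

section \<open>Integration by parts against test functions\<close>

lemma integrable_lebesgue_compact_support:
  fixes h :: "'a::euclidean_space \<Rightarrow> 'b::euclidean_space"
  assumes "compact K" "continuous_on K h" "\<And>x. x \<notin> K \<Longrightarrow> h x = 0"
  shows "integrable lebesgue h" "integrable lborel h"
proof -
  have "h = (\<lambda>x. indicator K x *\<^sub>R h x)"
    using assms(3) by (auto simp: indicator_def)
  then show I: "integrable lborel h"
    using borel_integrable_compact[OF assms(1,2)] by simp
  then show "integrable lebesgue h"
    using integrable_completion[of h lborel] by auto
qed

lemma C1cD:
  assumes "\<eta> \<in> C1c \<Omega>"
  shows "\<eta> differentiable (at x)" "continuous_on UNIV (grad \<eta>)"
    "compact (closure {x. \<eta> x \<noteq> 0})" "closure {x. \<eta> x \<noteq> 0} \<subseteq> \<Omega>"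
    "continuous_on UNIV \<eta>"
    "x \<notin> closure {x. \<eta> x \<noteq> 0} \<Longrightarrow> \<eta> x = 0"
    "x \<notin> closure {x. \<eta> x \<noteq> 0} \<Longrightarrow> grad \<eta> x = 0"
proof -
  show d: "\<eta> differentiable (at x)" for x using assms by (auto simp: C1c_def)
  show "continuous_on UNIV (grad \<eta>)" "compact (closure {x. \<eta> x \<noteq> 0})"
    "closure {x. \<eta> x \<noteq> 0} \<subseteq> \<Omega>"
    using assms by (auto simp: C1c_def)
  show "continuous_on UNIV \<eta>"
    using d by (simp add: continuous_on_eq_continuous_at differentiable_imp_continuous_within)
  show z: "x \<notin> closure {x. \<eta> x \<noteq> 0} \<Longrightarrow> \<eta> x = 0" for x
    using closure_subset[of "{x. \<eta> x \<noteq> 0}"] by blast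
  show "grad \<eta> x = 0" if "x \<notin> closure {x. \<eta> x \<noteq> 0}"
  proof (rule grad_eq_0)
    show "open (- closure {x. \<eta> x \<noteq> 0})" by (intro open_Compl closed_closure)
    show "x \<in> - closure {x. \<eta> x \<noteq> 0}" using that by (simp only: Compl_iff not_False_eq_True)
    show "\<eta> y = 0" if "y \<in> - closure {x. \<eta> x \<noteq> 0}" for y using z that by (simp only: Compl_iff not_False_eq_True)
  qed
qed

text \<open>The difference quotients of \<open>w\<close> in the direction of a unit vector have integral zero by
  translation invariance, and they converge to the partial derivative. Since \<open>w\<close> is Lipschitz with
  compact support, they are dominated by a multiple of the indicator of a ball.\<close>

lemma integral_grad_C1c:
  fixes w :: "real ^ 'n \<Rightarrow> real"
  assumes w: "w \<in> C1c \<Omega>"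
  shows "(LINT x|lebesgue. grad w x $ i) = 0"
proof -
  define K where "K = closure {x. w x \<noteq> 0}"
  note wD = C1cD[OF w, folded K_def]
  define e :: "real ^ 'n" where "e = axis i 1"
  define h where "h n = 1 / real (Suc n)" for n
  define s where "s n x = (w (x + h n *\<^sub>R e) - w x) / h n" for n x
  have e1: "norm e = 1" by (simp add: e_def)
  have h: "0 < h n" "h n \<le> 1" for n by (auto simp: h_def)
  have h0: "h \<longlonglongrightarrow> 0" unfolding h_def by (rule LIMSEQ_Suc, rule lim_1_over_n)
  obtain r where r: "\<And>x. x \<in> K \<Longrightarrow> norm x \<le> r"
    using compact_imp_bounded[OF wD(3)] by (auto simp: bounded_iff)
  have "bounded (grad w ` K)"
    by (intro compact_imp_bounded compact_continuous_image wD(3) continuous_on_subset[OF wD(2)]) auto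
  then obtain B0 where B0: "\<And>x. x \<in> K \<Longrightarrow> norm (grad w x) \<le> B0"
    by (auto simp: bounded_iff)
  define B where "B = max B0 0"
  have B: "norm (grad w x) \<le> B" for x
    using B0[of x] wD(7)[of x] by (cases "x \<in> K") (auto simp: B_def)
  have lip: "norm (w y - w x) \<le> B * norm (y - x)" for x y
  proof (rule differentiable_bound[of UNIV w "\<lambda>x h. grad w x \<bullet> h"])
    fix z
    show "(w has_derivative (\<lambda>h. grad w z \<bullet> h)) (at z)"
      by (rule has_derivative_grad[OF wD(1)])
    show "onorm (\<lambda>h. grad w z \<bullet> h) \<le> B"
    proof (rule onorm_le)
      fix v
      have "norm (grad w z \<bullet> v) \<le> norm (grad w z) * norm v"
        using Cauchy_Schwarz_ineq2 by auto
      also have "\<dots> \<le> B * norm v" by (intro mult_right_mono B) auto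
      finally show "norm (grad w z \<bullet> v) \<le> B * norm v" .
    qed
  qed auto
  have wint: "integrable lborel w"
    by (rule integrable_lebesgue_compact_support(2)[OF wD(3)])
       (auto intro: continuous_on_subset[OF wD(5)] wD(6))
  have transl: "integrable lborel (\<lambda>x. w (x + c)) \<and> (LINT x|lborel. w (x + c)) = (LINT x|lborel. w x)" for c
  proof -
    have D: "distr lborel borel ((+) c) = lborel" by (rule lborel_distr_plus)
    have 1: "integrable (distr lborel borel ((+) c)) w" using wint by (simp add: D)
    have "integrable lborel (\<lambda>x. w (c + x))"
      by (rule integrable_distr[OF _ 1]) simp
    moreover have "integral\<^sup>L (distr lborel borel ((+) c)) w = (LINT x|lborel. w (c + x))"
      by (rule integral_distr) (use wint in auto)
    ultimately show ?thesis by (simp add: D add.commute)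
  qed
  have s0: "(LINT x|lborel. s n x) = 0" for n
    using transl[of "h n *\<^sub>R e"] wint by (simp add: s_def)
  have gmeas: "(\<lambda>x. grad w x $ i) \<in> borel_measurable lborel"
    using borel_measurable_continuous_onI[of "\<lambda>x. grad w x $ i"] wD(2)
    by (auto intro!: continuous_intros)
  have "(\<lambda>n. LINT x|lborel. s n x) \<longlonglongrightarrow> (LINT x|lborel. grad w x $ i)"
  proof (rule integral_dominated_convergence[where w = "\<lambda>x. indicator (cball 0 (r + 1)) x *\<^sub>R B"])
    show "(\<lambda>x. grad w x $ i) \<in> borel_measurable lborel" by (rule gmeas)
    show "s n \<in> borel_measurable lborel" for n
      using borel_measurable_continuous_onI[OF wD(5)]
      unfolding s_def by measurable
    show "integrable lborel (\<lambda>x::real^'n. indicator (cball 0 (r + 1)) x *\<^sub>R B)"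
      by (rule borel_integrable_compact) auto
    show "AE x in lborel. (\<lambda>n. s n x) \<longlonglongrightarrow> grad w x $ i"
    proof (rule AE_I2)
      fix x
      have "((\<lambda>u. w (x + u *\<^sub>R e)) has_derivative (\<lambda>u. grad w x \<bullet> (u *\<^sub>R e))) (at 0)"
      proof (rule has_derivative_compose[where g = w and f = "\<lambda>u. x + u *\<^sub>R e"])
        show "((\<lambda>u. x + u *\<^sub>R e) has_derivative (\<lambda>u. u *\<^sub>R e)) (at 0)"
          by (auto intro!: derivative_eq_intros)
        show "(w has_derivative (\<lambda>h. grad w x \<bullet> h)) (at (x + 0 *\<^sub>R e))"
          using has_derivative_grad[OF wD(1)] by simp
      qed
      moreover have "(\<lambda>u. grad w x \<bullet> (u *\<^sub>R e)) = (*) (grad w x $ i)"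
        by (auto simp: e_def inner_axis)
      ultimately have "((\<lambda>u. w (x + u *\<^sub>R e)) has_field_derivative grad w x $ i) (at 0)"
        by (simp add: has_field_derivative_def)
      then have *: "((\<lambda>u. (w (x + u *\<^sub>R e) - w x) / u) \<longlongrightarrow> grad w x $ i) (at 0)"
        by (simp add: has_field_derivative_iff)
      have "filterlim h (at 0) sequentially"
        using h0 h by (auto simp: filterlim_at intro!: always_eventually) (metis less_irrefl)
      from filterlim_compose[OF * this] show "(\<lambda>n. s n x) \<longlonglongrightarrow> grad w x $ i"
        by (simp add: s_def)
    qed
    show "AE x in lborel. norm (s n x) \<le> indicator (cball 0 (r + 1)) x *\<^sub>R B" for n
    proof (rule AE_I2)
      fix x :: "real ^ 'n"
      show "norm (s n x) \<le> indicator (cball 0 (r + 1)) x *\<^sub>R B"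
      proof (cases "norm x \<le> r + 1")
        case True
        have "norm (w (x + h n *\<^sub>R e) - w x) \<le> B * h n"
          using lip[of "x + h n *\<^sub>R e" x] h[of n] e1 by simp
        then show ?thesis
          using True h[of n] by (simp add: s_def divide_simps)
      next
        case False
        have "norm x \<le> norm (x + h n *\<^sub>R e) + norm (h n *\<^sub>R e)"
          by (metis add_diff_cancel_right' norm_triangle_ineq4)
        also have "norm (h n *\<^sub>R e) \<le> 1" using h[of n] e1 by simp
        finally have "x + h n *\<^sub>R e \<notin> K" "x \<notin> K"
          using False r[of "x + h n *\<^sub>R e"] r[of x] by auto
        then show ?thesis using wD(6) False by (simp add: s_def)
      qed
    qed
  qed
  then have "(LINT x|lborel. grad w x $ i) = 0"
    by (simp add: s0 LIMSEQ_const_iff)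
  then show ?thesis
    using integral_completion[OF gmeas] by simp
qed

text \<open>The product with a test function needs no cut-off of \<open>f\<close>: off the support of \<open>\<eta>\<close>, both sides
  of the product rule vanish whatever values \<open>f\<close> and \<open>grad f\<close> take there.\<close>

lemma C1c_mult:
  fixes f \<eta> :: "real ^ 'n \<Rightarrow> real"
  assumes "open \<Omega>" and f: "\<And>x. x \<in> \<Omega> \<Longrightarrow> f differentiable (at x)"
    and gf: "continuous_on \<Omega> (grad f)" and \<eta>: "\<eta> \<in> C1c \<Omega>"
  shows "(\<lambda>x. f x * \<eta> x) \<in> C1c \<Omega>"
    "grad (\<lambda>x. f x * \<eta> x) x = f x *\<^sub>R grad \<eta> x + \<eta> x *\<^sub>R grad f x"
proof -
  define K where "K = closure {x. \<eta> x \<noteq> 0}"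
  note \<eta>D = C1cD[OF \<eta>, folded K_def]
  let ?w = "\<lambda>x. f x * \<eta> x" and ?g = "\<lambda>x. f x *\<^sub>R grad \<eta> x + \<eta> x *\<^sub>R grad f x"
  have oK: "open (- K)" unfolding K_def by (intro open_Compl closed_closure)
  have D: "(?w has_derivative (\<lambda>h. ?g x \<bullet> h)) (at x)" for x
  proof (cases "x \<in> \<Omega>")
    case True
    have "(\<lambda>h. ?g x \<bullet> h) = (\<lambda>h. f x * (grad \<eta> x \<bullet> h) + (grad f x \<bullet> h) * \<eta> x)"
      by (simp add: inner_add_left mult.commute)
    then show ?thesis
      using has_derivative_mult[OF has_derivative_grad[OF f[OF True]] has_derivative_grad[OF \<eta>D(1)]]
      by (simp only:)
  next
    case False
    then have x: "x \<in> - K" using \<eta>D(4) by auto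
    have "(?w has_derivative (\<lambda>h. 0)) (at x)"
      by (rule has_derivative_transform_within_open[of "\<lambda>_. 0" _ x UNIV "- K"])
         (use x oK \<eta>D(6) in auto)
    then show ?thesis using x \<eta>D(6,7) by simp
  qed
  show G: "grad ?w x = ?g x" for x by (rule grad_eqI[OF D])
  have cf: "continuous_on \<Omega> f"
    using f by (intro continuous_at_imp_continuous_on) (auto intro: differentiable_imp_continuous_within)
  have "continuous_on \<Omega> ?g"
    by (intro continuous_intros cf gf continuous_on_subset[OF \<eta>D(2)] continuous_on_subset[OF \<eta>D(5)]) auto
  moreover have "continuous_on (- K) ?g"
    by (rule continuous_on_eq[of _ "\<lambda>_. 0"]) (auto simp: \<eta>D)
  ultimately have "continuous_on (\<Omega> \<union> - K) ?g"
    using \<open>open \<Omega>\<close> oK by (intro continuous_on_open_Un)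
  moreover have "\<Omega> \<union> - K = UNIV" using \<eta>D(4) by auto
  moreover have "grad ?w = ?g" using G by (rule ext)
  ultimately have "continuous_on UNIV (grad ?w)" by simp
  moreover have "closure {x. ?w x \<noteq> 0} \<subseteq> K" unfolding K_def by (rule closure_mono) auto
  moreover from this have "compact (closure {x. ?w x \<noteq> 0})"
    using compact_Int_closed[OF \<eta>D(3) closed_closure[of "{x. ?w x \<noteq> 0}"]] by (simp only: Int_absorb1)
  moreover have "?w differentiable (at x)" for x using D by (auto simp: differentiable_def)
  ultimately show "?w \<in> C1c \<Omega>" using \<eta>D(4) by (auto simp: C1c_def)
qed

lemma set_integrable_test:
  fixes f :: "real ^ 'n \<Rightarrow> real"
  assumes f: "continuous_on \<Omega> f" and \<eta>: "\<eta> \<in> C1c \<Omega>"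
  shows "set_integrable lebesgue \<Omega> (\<lambda>x. f x * \<eta> x)"
    and "set_integrable lebesgue \<Omega> (\<lambda>x. f x * grad \<eta> x $ i)"
proof -
  define K where "K = closure {x. \<eta> x \<noteq> 0}"
  note \<eta>D = C1cD[OF \<eta>, folded K_def]
  have *: "set_integrable lebesgue \<Omega> (\<lambda>x. f x * k x)"
    if "continuous_on UNIV k" "\<And>x. x \<notin> K \<Longrightarrow> k x = 0" for k
    unfolding set_integrable_def
  proof (rule integrable_lebesgue_compact_support(1)[OF \<eta>D(3)])
    have "continuous_on K (\<lambda>x. f x * k x)"
      by (intro continuous_intros continuous_on_subset[OF f \<eta>D(4)] continuous_on_subset[OF that(1)]) auto
    then show "continuous_on K (\<lambda>x. indicator \<Omega> x *\<^sub>R (f x * k x))"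
      by (rule continuous_on_eq) (use \<eta>D(4) in auto)
  qed (simp add: that)
  show "set_integrable lebesgue \<Omega> (\<lambda>x. f x * \<eta> x)" by (rule *) (auto simp: \<eta>D)
  show "set_integrable lebesgue \<Omega> (\<lambda>x. f x * grad \<eta> x $ i)"
    by (rule *) (auto simp: \<eta>D intro!: continuous_intros)
qed

lemma integration_by_parts:
  fixes f :: "real ^ 'n \<Rightarrow> real"
  assumes "open \<Omega>" and f: "\<And>x. x \<in> \<Omega> \<Longrightarrow> f differentiable (at x)"
    and gf: "continuous_on \<Omega> (grad f)" and \<eta>: "\<eta> \<in> C1c \<Omega>"
  shows "(LINT x:\<Omega>|lebesgue. f x * grad \<eta> x $ i) = - (LINT x:\<Omega>|lebesgue. grad f x $ i * \<eta> x)"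
proof -
  have cf: "continuous_on \<Omega> f"
    using f by (intro continuous_at_imp_continuous_on) (auto intro: differentiable_imp_continuous_within)
  have cg: "continuous_on \<Omega> (\<lambda>x. grad f x $ i)" by (intro continuous_intros gf)
  have "0 = (LINT x|lebesgue. grad (\<lambda>x. f x * \<eta> x) x $ i)"
    by (rule integral_grad_C1c[OF C1c_mult(1)[OF assms], symmetric])
  also have "\<dots> = (LINT x:\<Omega>|lebesgue. f x * grad \<eta> x $ i + grad f x $ i * \<eta> x)"
    unfolding set_lebesgue_integral_def
  proof (rule Bochner_Integration.integral_cong)
    fix x
    have "x \<notin> \<Omega> \<Longrightarrow> \<eta> x = 0 \<and> grad \<eta> x = 0"
      using C1cD[OF \<eta>] by blast
    then show "grad (\<lambda>x. f x * \<eta> x) x $ i = indicator \<Omega> x *\<^sub>R (f x * grad \<eta> x $ i + grad f x $ i * \<eta> x)"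
      by (cases "x \<in> \<Omega>") (simp_all add: C1c_mult(2)[OF assms])
  qed simp
  also have "\<dots> = (LINT x:\<Omega>|lebesgue. f x * grad \<eta> x $ i) + (LINT x:\<Omega>|lebesgue. grad f x $ i * \<eta> x)"
    by (rule set_integral_add(2)[OF set_integrable_test(2)[OF cf \<eta>] set_integrable_test(1)[OF cg \<eta>]])
  finally show ?thesis by simp
qed

lemma Lp_loc_continuous:
  fixes f :: "real ^ 'n \<Rightarrow> 'b::euclidean_space"
  assumes f: "continuous_on \<Omega> f" and "p > 0"
  shows "Lp_loc p \<Omega> f"
  unfolding Lp_loc_def
proof (intro allI impI)
  fix K assume K: "compact K \<and> K \<subseteq> \<Omega>"
  have fK: "continuous_on K f" using continuous_on_subset[OF f] K by auto
  have *: "set_integrable lebesgue K g" if "continuous_on K g" for g :: "real ^ 'n \<Rightarrow> 'c::euclidean_space"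
    unfolding set_integrable_def
    by (rule integrable_lebesgue_compact_support(1)[of K])
       (use K in \<open>auto intro: continuous_on_eq[OF that]\<close>)
  have "continuous_on K (\<lambda>x. norm (f x) powr p)"
    by (intro continuous_on_powr' continuous_intros fK) (use \<open>p > 0\<close> in auto)
  from *[OF this] *[OF fK] show "set_borel_measurable lebesgue K f \<and> set_integrable lebesgue K (\<lambda>x. norm (f x) powr p)"
    by (auto simp: set_borel_measurable_def set_integrable_def)
qed

section \<open>Powers of the norm\<close>

lemma norm_powr_has_derivative:
  fixes x :: "real ^ 'n"
  assumes "x \<noteq> 0"
  shows "((\<lambda>x. norm x powr s) has_derivative (\<lambda>h. ((s * norm x powr (s - 2)) *\<^sub>R x) \<bullet> h)) (at x)"
proof -
  have n: "0 < norm x" using assms by simp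
  have D: "((\<lambda>y. norm y powr s) has_derivative
      (\<lambda>h. norm x powr s * (0 * ln (norm x) + (h \<bullet> sgn x) * s / norm x))) (at x)"
    by (rule has_derivative_powr[OF has_derivative_norm[OF assms] has_derivative_const[of s]])
       (use n in auto)
  have "norm x powr s = norm x powr (s - 2) * norm x * norm x"
    using powr_add[of "norm x" "s - 2" 2] n by (simp add: power2_eq_square mult.assoc)
  then have "(\<lambda>h. norm x powr s * (0 * ln (norm x) + (h \<bullet> sgn x) * s / norm x)) =
      (\<lambda>h. ((s * norm x powr (s - 2)) *\<^sub>R x) \<bullet> h)"
    using n by (auto simp: sgn_div_norm inner_commute)
  with D show ?thesis by (simp only:)
qed

lemma norm_powr_C1:
  fixes \<Omega> :: "(real ^ 'n) set"
  assumes "0 \<notin> \<Omega>"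
  shows "x \<in> \<Omega> \<Longrightarrow> (\<lambda>x. norm x powr s) differentiable (at x)"
    and "x \<in> \<Omega> \<Longrightarrow> grad (\<lambda>x. norm x powr s) x = (s * norm x powr (s - 2)) *\<^sub>R x"
    and "continuous_on \<Omega> (\<lambda>x. norm x powr s)"
proof -
  show "(\<lambda>x. norm x powr s) differentiable (at x)" if "x \<in> \<Omega>" for x
    using norm_powr_has_derivative[of x s] that assms by (auto simp: differentiable_def)
  show "grad (\<lambda>x. norm x powr s) x = (s * norm x powr (s - 2)) *\<^sub>R x" if "x \<in> \<Omega>" for x
    by (rule grad_eqI[OF norm_powr_has_derivative]) (use that assms in auto)
  show "continuous_on \<Omega> (\<lambda>x. norm x powr s)"
    by (intro continuous_intros) (use assms in auto)
qed

text \<open>This is the weak form of \<open>div (\<bar>x\<bar>\<^sup>s x) = (N + s) \<bar>x\<bar>\<^sup>s\<close>.\<close>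

lemma integral_radial_field:
  fixes \<Omega> :: "(real ^ 'n) set"
  assumes "open \<Omega>" "0 \<notin> \<Omega>" and \<eta>: "\<eta> \<in> C1c \<Omega>"
  shows "(LINT x:\<Omega>|lebesgue. (norm x powr s *\<^sub>R x) \<bullet> grad \<eta> x) =
    - ((real CARD('n) + s) * (LINT x:\<Omega>|lebesgue. norm x powr s * \<eta> x))"
proof -
  define f where "f i x = norm x powr s * x $ i" for i and x :: "real ^ 'n"
  define g where "g i x = (x $ i * (s * norm x powr (s - 2))) *\<^sub>R x + norm x powr s *\<^sub>R axis i 1"
    for i and x :: "real ^ 'n"
  have D: "(f i has_derivative (\<lambda>h. g i x \<bullet> h)) (at x)" if "x \<in> \<Omega>" for x i
  proof -
    have "x \<noteq> 0" using that assms by auto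
    from has_derivative_mult[OF norm_powr_has_derivative[OF this, of s]
        bounded_linear.has_derivative[OF bounded_linear_vec_nth has_derivative_ident, of i]]
    show ?thesis
      unfolding f_def g_def
      by (simp add: inner_add_left inner_axis' algebra_simps)
  qed
  have df: "f i differentiable (at x)" if "x \<in> \<Omega>" for x i
    using D[OF that] by (auto simp: differentiable_def)
  have G: "grad (f i) x = g i x" if "x \<in> \<Omega>" for x i using D[OF that] by (rule grad_eqI)
  have cg: "continuous_on \<Omega> (g i)" for i
    unfolding g_def by (intro continuous_intros norm_powr_C1(3)) (use assms in auto)
  then have cG: "continuous_on \<Omega> (grad (f i))" for i
    by (rule continuous_on_eq) (simp add: G)
  have cf: "continuous_on \<Omega> (f i)" for i
    unfolding f_def by (intro continuous_intros norm_powr_C1(3) assms)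
  have cGi: "continuous_on \<Omega> (\<lambda>x. grad (f i) x $ i)" for i by (intro continuous_intros cG)
  have sum: "(LINT x:\<Omega>|lebesgue. \<Sum>i\<in>UNIV. k i x) = (\<Sum>i\<in>UNIV. LINT x:\<Omega>|lebesgue. k i x)"
    if "\<And>i. set_integrable lebesgue \<Omega> (k i)" for k :: "'n \<Rightarrow> real ^ 'n \<Rightarrow> real"
    using that unfolding set_integrable_def set_lebesgue_integral_def scaleR_sum_right
    by (intro Bochner_Integration.integral_sum) auto
  have "(LINT x:\<Omega>|lebesgue. (norm x powr s *\<^sub>R x) \<bullet> grad \<eta> x) =
      (LINT x:\<Omega>|lebesgue. \<Sum>i\<in>UNIV. f i x * grad \<eta> x $ i)"
    by (simp add: inner_vec_def f_def mult.assoc)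
  also have "\<dots> = (\<Sum>i\<in>UNIV. LINT x:\<Omega>|lebesgue. f i x * grad \<eta> x $ i)"
    by (rule sum) (rule set_integrable_test(2)[OF cf \<eta>])
  also have "\<dots> = - (\<Sum>i\<in>UNIV. LINT x:\<Omega>|lebesgue. grad (f i) x $ i * \<eta> x)"
    by (simp add: integration_by_parts[OF assms(1) df cG \<eta>] sum_negf)
  also have "(\<Sum>i\<in>UNIV. LINT x:\<Omega>|lebesgue. grad (f i) x $ i * \<eta> x) =
      (LINT x:\<Omega>|lebesgue. \<Sum>i\<in>UNIV. grad (f i) x $ i * \<eta> x)"
    by (rule sum[symmetric]) (rule set_integrable_test(1)[OF cGi \<eta>])
  also have "\<dots> = (LINT x:\<Omega>|lebesgue. (real CARD('n) + s) * (norm x powr s * \<eta> x))"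
  proof (rule set_lebesgue_integral_cong, use \<open>open \<Omega>\<close> in simp, intro allI impI)
    fix x assume x: "x \<in> \<Omega>"
    then have n: "0 < norm x" using assms by auto
    have "(\<Sum>i\<in>UNIV. g i x $ i) =
        s * norm x powr (s - 2) * (\<Sum>i\<in>UNIV. x $ i * x $ i) + real CARD('n) * norm x powr s"
      by (simp add: g_def sum.distrib sum_distrib_left algebra_simps)
    also have "(\<Sum>i\<in>UNIV. x $ i * x $ i) = norm x powr 2"
      using n by (simp add: inner_vec_def power2_norm_eq_inner[of x])
    also have "s * norm x powr (s - 2) * norm x powr 2 = s * norm x powr s"
      using powr_add[of "norm x" "s - 2" 2] by simp
    finally show "(\<Sum>i\<in>UNIV. grad (f i) x $ i * \<eta> x) = (real CARD('n) + s) * (norm x powr s * \<eta> x)"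
      by (simp only: G[OF x] sum_distrib_right[symmetric]) (simp only: algebra_simps)
  qed
  also have "\<dots> = (real CARD('n) + s) * (LINT x:\<Omega>|lebesgue. norm x powr s * \<eta> x)" by simp
  finally show ?thesis .
qed

lemma flux_radial:
  fixes x :: "real ^ 'n"
  assumes "x \<noteq> 0" "a > 0"
  shows "flux r (((- a) * norm x powr (- a - 2)) *\<^sub>R x) =
    (- (a powr (r - 1))) *\<^sub>R (norm x powr (- (a + 1) * (r - 1) - 1) *\<^sub>R x)"
proof -
  have n: "0 < norm x" using assms by simp
  have "norm x powr (- a - 2) * norm x powr 1 = norm x powr (- a - 1)"
    unfolding powr_add[symmetric] by (rule arg_cong) simp
  then have "norm (((- a) * norm x powr (- a - 2)) *\<^sub>R x) = a * norm x powr (- a - 1)"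
    using assms(2) by (simp add: abs_mult mult.assoc)
  then have "flux r (((- a) * norm x powr (- a - 2)) *\<^sub>R x) =
      (- ((a * norm x powr (- a - 1)) powr (r - 2) * (a * norm x powr (- a - 2)))) *\<^sub>R x"
    by (simp add: flux_def)
  also have "(a * norm x powr (- a - 1)) powr (r - 2) * (a * norm x powr (- a - 2)) =
      (a powr (r - 2) * a powr 1) * (norm x powr ((- a - 1) * (r - 2)) * norm x powr (- a - 2))"
    using n assms(2) by (simp add: powr_mult powr_powr)
  also have "\<dots> = a powr (r - 1) * norm x powr (- (a + 1) * (r - 1) - 1)"
    unfolding powr_add[symmetric] by (simp add: algebra_simps)
  finally show ?thesis by simp
qed

section \<open>Choice of the exponent and of the radius\<close>

text \<open>With \<open>s = -(a+1)(q-1) - 1\<close>, the second property is \<open>a < (N-q)/(q-1)\<close> and makes \<open>\<bar>x\<bar>\<^sup>-\<^sup>a\<close> strictly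
  \<open>q\<close>-superharmonic; the third is \<open>a > q/(t-q)\<close> and makes the reaction term decay faster than
  \<open>-\<Delta>\<^sub>q \<bar>x\<bar>\<^sup>-\<^sup>a\<close>.\<close>

lemma exponent_window:
  fixes q N t :: real
  assumes "1 < q" "q < N" "t > q_star N q"
  obtains a where "a > 0" "0 < N + (- (a + 1) * (q - 1) - 1)"
    "- a * (t - 1) < - (a + 1) * (q - 1) - 1"
proof -
  have t: "q * (N - 1) < t * (N - q)"
    using assms by (simp add: q_star_def divide_simps)
  have "q * (N - q) < q * (N - 1)" using assms by simp
  then have tq: "q < t" using t assms by (metis diff_gt_0_iff_gt less_trans mult_less_cancel_right_pos)
  have "q / (t - q) < (N - q) / (q - 1)"
    using t tq assms by (simp add: divide_simps) (simp add: algebra_simps)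
  then obtain a where a: "q / (t - q) < a" "a < (N - q) / (q - 1)" using dense by blast
  have "0 < q / (t - q)" using tq assms by simp
  with a have "a > 0" by linarith
  moreover have "a * (q - 1) < N - q" "q < a * (t - q)"
    using a tq assms by (simp_all add: divide_simps mult.commute)
  ultimately show ?thesis by (intro that[of a]) (auto simp: algebra_simps)
qed

text \<open>\<open>B\<close> may be negative: it will be the coefficient of the \<open>p\<close>-Laplacian term.\<close>

lemma powr_dominates:
  fixes A B \<alpha> \<beta> \<gamma> :: real
  assumes "A > 0" "\<beta> < \<alpha>" "\<gamma> < \<alpha>"
  obtains R where "R > 0" "\<And>r. r > R \<Longrightarrow> r powr \<gamma> \<le> B * r powr \<beta> + A * r powr \<alpha>"
proof -
  have l: "((\<lambda>r::real. r powr (c - \<alpha>)) \<longlongrightarrow> 0) at_top" if "c < \<alpha>" for c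
    by (rule tendsto_neg_powr[OF _ filterlim_ident]) (use that in simp)
  have "((\<lambda>r. r powr (\<gamma> - \<alpha>) - B * r powr (\<beta> - \<alpha>)) \<longlongrightarrow> 0 - B * 0) at_top"
    by (intro tendsto_intros l assms)
  then have "eventually (\<lambda>r. r powr (\<gamma> - \<alpha>) - B * r powr (\<beta> - \<alpha>) < A) at_top"
    using \<open>A > 0\<close> by (auto dest: order_tendstoD(2))
  then obtain R where R: "\<And>r. r \<ge> R \<Longrightarrow> r powr (\<gamma> - \<alpha>) - B * r powr (\<beta> - \<alpha>) < A"
    by (auto simp: eventually_at_top_linorder)
  show ?thesis
  proof (rule that[of "max R 1"])
    fix r assume r: "r > max R 1"
    then have "(r powr (\<gamma> - \<alpha>) - B * r powr (\<beta> - \<alpha>)) * r powr \<alpha> \<le> A * r powr \<alpha>"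
      by (intro mult_right_mono less_imp_le[OF R]) auto
    then show "r powr \<gamma> \<le> B * r powr \<beta> + A * r powr \<alpha>"
      by (simp add: left_diff_distrib mult.assoc powr_add[symmetric])
  qed simp
qed

section \<open>The supersolution\<close>

theorem mainTheorem5:
  fixes p q t :: real
  assumes "1 < q" and "q < p"
    and "q < real CARD('n::finite)"
    and "t > q_star (real CARD('n)) q"
  shows "\<exists>R\<^sub>0>0. \<exists>\<phi> :: real ^ 'n \<Rightarrow> real.
           positive_pq_supersolution p q t {x. norm x > R\<^sub>0} \<phi>"
proof -
  let ?N = "real CARD('n)"
  obtain a where a: "a > 0" "0 < ?N + (- (a + 1) * (q - 1) - 1)"
    "- a * (t - 1) < - (a + 1) * (q - 1) - 1"
    using exponent_window[OF assms(1,3,4)] .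
  define s where "s r = - (a + 1) * (r - 1) - 1" for r
  define c where "c r = a powr (r - 1) * (?N + s r)" for r
  have cq: "c q > 0" using a by (simp add: c_def s_def)
  have "(a + 1) * (q - 1) < (a + 1) * (p - 1)" using a assms by simp
  then have spq: "s p < s q" unfolding s_def minus_mult_left[symmetric] by linarith
  obtain R where R: "R > 0"
    "\<And>r. r > R \<Longrightarrow> r powr (- a * (t - 1)) \<le> c p * r powr (s p) + c q * r powr (s q)"
    using powr_dominates[OF cq spq a(3)[folded s_def], of "c p"] by blast
  define \<Omega> :: "(real ^ 'n) set" where "\<Omega> = {x. norm x > R}"
  have \<Omega>: "open \<Omega>" "0 \<notin> \<Omega>" using R(1) by (auto simp: \<Omega>_def intro!: open_Collect_less continuous_intros)
  define \<phi> where "\<phi> x = norm x powr (- a)" for x :: "real ^ 'n"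
  define g where "g x = ((- a) * norm x powr (- a - 2)) *\<^sub>R x" for x :: "real ^ 'n"
  have c\<phi>: "continuous_on \<Omega> \<phi>" unfolding \<phi>_def by (rule norm_powr_C1(3)[OF \<Omega>(2)])
  have cg: "continuous_on \<Omega> g" unfolding g_def by (intro continuous_intros norm_powr_C1(3) \<Omega>)
  have d\<phi>: "\<phi> differentiable (at x)" if "x \<in> \<Omega>" for x
    unfolding \<phi>_def by (rule norm_powr_C1(1)[OF \<Omega>(2) that])
  have grad\<phi>: "grad \<phi> x = g x" if "x \<in> \<Omega>" for x
    unfolding \<phi>_def g_def by (rule norm_powr_C1(2)[OF \<Omega>(2) that])
  have cgrad: "continuous_on \<Omega> (grad \<phi>)" by (rule continuous_on_eq[OF cg]) (simp add: grad\<phi>)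
  have "weak_gradient \<Omega> \<phi> g"
    unfolding weak_gradient_def
  proof (intro conjI ballI allI)
    fix \<eta> i assume \<eta>: "\<eta> \<in> C1c \<Omega>"
    have "(LINT x:\<Omega>|lebesgue. grad \<phi> x $ i * \<eta> x) = (LINT x:\<Omega>|lebesgue. g x $ i * \<eta> x)"
      by (rule set_lebesgue_integral_cong) (use \<Omega> in \<open>auto simp: grad\<phi>\<close>)
    then show "(LINT x:\<Omega>|lebesgue. \<phi> x * grad \<eta> x $ i) = - (LINT x:\<Omega>|lebesgue. g x $ i * \<eta> x)"
      using integration_by_parts[OF \<Omega>(1) d\<phi> cgrad \<eta>, of i] by simp
  qed (auto intro: Lp_loc_continuous c\<phi> cg)
  then have W: "W1p_loc_grad p \<Omega> \<phi> g"
    using assms by (auto simp: W1p_loc_grad_def intro!: Lp_loc_continuous c\<phi> cg)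
  have flux: "(LINT x:\<Omega>|lebesgue. flux r (g x) \<bullet> grad \<eta> x) =
      c r * (LINT x:\<Omega>|lebesgue. norm x powr s r * \<eta> x)" if \<eta>: "\<eta> \<in> C1c \<Omega>" for r \<eta>
  proof -
    have "(LINT x:\<Omega>|lebesgue. flux r (g x) \<bullet> grad \<eta> x) =
        (LINT x:\<Omega>|lebesgue. (- (a powr (r - 1))) * ((norm x powr s r *\<^sub>R x) \<bullet> grad \<eta> x))"
    proof (rule set_lebesgue_integral_cong, use \<Omega> in simp, intro allI impI)
      fix x assume "x \<in> \<Omega>"
      then have "x \<noteq> 0" using \<Omega> by auto
      then show "flux r (g x) \<bullet> grad \<eta> x = (- (a powr (r - 1))) * ((norm x powr s r *\<^sub>R x) \<bullet> grad \<eta> x)"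
        unfolding g_def s_def by (simp only: flux_radial[OF _ a(1)] not_False_eq_True inner_scaleR_left)
    qed
    also have "\<dots> = (- (a powr (r - 1))) * (LINT x:\<Omega>|lebesgue. (norm x powr s r *\<^sub>R x) \<bullet> grad \<eta> x)"
      by (rule set_integral_mult_right)
    finally show ?thesis
      unfolding integral_radial_field[OF \<Omega> \<eta>] c_def by simp
  qed
  have "(LINT x:\<Omega>|lebesgue. flux p (g x) \<bullet> grad \<eta> x) + (LINT x:\<Omega>|lebesgue. flux q (g x) \<bullet> grad \<eta> x)
      \<ge> (LINT x:\<Omega>|lebesgue. \<phi> x powr (t - 1) * \<eta> x)"
    if \<eta>: "\<eta> \<in> C1c \<Omega>" and pos: "\<forall>x. \<eta> x \<ge> 0" for \<eta>
  proof -
    note I = set_integrable_test(1)[OF norm_powr_C1(3)[OF \<Omega>(2)] \<eta>]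
    have Ic: "set_integrable lebesgue \<Omega> (\<lambda>x. c r * (norm x powr s r * \<eta> x))" for r
      using I[of "s r"] by simp
    have "(LINT x:\<Omega>|lebesgue. \<phi> x powr (t - 1) * \<eta> x) = (LINT x:\<Omega>|lebesgue. norm x powr (- a * (t - 1)) * \<eta> x)"
      by (simp add: \<phi>_def powr_powr)
    also have "\<dots> \<le> (LINT x:\<Omega>|lebesgue. c p * (norm x powr s p * \<eta> x) + c q * (norm x powr s q * \<eta> x))"
    proof (rule set_integral_mono[OF I set_integral_add(1)[OF Ic Ic]])
      fix x assume "x \<in> \<Omega>"
      then have "norm x powr (- a * (t - 1)) * \<eta> x \<le> (c p * norm x powr s p + c q * norm x powr s q) * \<eta> x"
        using pos R(2)[of "norm x"] by (intro mult_right_mono) (auto simp: \<Omega>_def)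
      then show "norm x powr (- a * (t - 1)) * \<eta> x \<le>
          c p * (norm x powr s p * \<eta> x) + c q * (norm x powr s q * \<eta> x)"
        by (simp add: algebra_simps)
    qed
    also have "\<dots> = c p * (LINT x:\<Omega>|lebesgue. norm x powr s p * \<eta> x) +
        c q * (LINT x:\<Omega>|lebesgue. norm x powr s q * \<eta> x)"
      by (subst set_integral_add(2)[OF Ic Ic]) simp
    finally show ?thesis by (simp add: flux[OF \<eta>])
  qed
  moreover have "\<forall>x\<in>\<Omega>. \<phi> x > 0" using \<Omega>(2) by (auto simp: \<phi>_def)
  ultimately have "positive_pq_supersolution p q t \<Omega> \<phi>"
    unfolding positive_pq_supersolution_def using W \<Omega>(1) c\<phi> by blast
  then show ?thesis using R(1) unfolding \<Omega>_def by blast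
qed

end
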